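(* Let $p_1,p_2$ be distinct odd primes and let $(a_i)$ be the prime Fibonacci sequence generated by $p_1,p_2$ (so $a_1=p_1$, $a_2=p_2$). Then the sequence terminates in a power of 2: it is finite, and there is an index $N\ge 2$ such that $a_{N-1}+a_N$ is a power of $2$.
   Context: For odd primes $p_1,p_2$, the prime Fibonacci sequence generated by $p_1,p_2$ is the sequence $(a_i)$ with $a_1=p_1$, $a_2=p_2$, and, for $i\ge 1$: if $a_i+a_{i+1}$ is not a power of $2$, then $a_{i+2}$ is the smallest odd prime divisor of $a_i+a_{i+1}$; if $a_i+a_{i+1}$ is a power of $2$, the sequence terminates (with last term $a_{i+1}$). *)

theory Defs
  imports "HOL-Computational_Algebra.Primes"
begin

definition power_of_two :: "nat \<Rightarrow> bool" where
  "power_of_two n \<longleftrightarrow> (\<exists>k. n = 2 ^ k)"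

definition smallest_odd_prime_divisor :: "nat \<Rightarrow> nat" where
  "smallest_odd_prime_divisor n = (LEAST q. prime q \<and> odd q \<and> q dvd n)"

text \<open>
  Terms are indexed from 1; the value \<^const>\<open>None\<close> means that there is no term with that index
  (index 0, and every index after termination), so the index set of the sequence is its \<^const>\<open>dom\<close>.
\<close>
fun prime_fib :: "nat \<Rightarrow> nat \<Rightarrow> nat \<Rightarrow> nat option" where
  "prime_fib p1 p2 0 = None"
| "prime_fib p1 p2 (Suc 0) = Some p1"
| "prime_fib p1 p2 (Suc (Suc 0)) = Some p2"
| "prime_fib p1 p2 (Suc (Suc (Suc i))) =
     (case (prime_fib p1 p2 (Suc i), prime_fib p1 p2 (Suc (Suc i))) of
        (Some x, Some y) \<Rightarrow>
          if power_of_two (x + y) then None else Some (smallest_odd_prime_divisor (x + y))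
      | _ \<Rightarrow> None)"

end

theory Submission
  imports Defs
begin

text \<open>
  Consecutive terms stay distinct: if the new term equalled its predecessor, that prime would divide
  the term before it. As \<open>x + y\<close> is even, the term following \<open>x \<noteq> y\<close> is at most
  \<open>(x + y) / 2 < max x y\<close>. Hence the maximum of two consecutive terms never increases, and it
  drops within two steps, so the sequence must stop.
\<close>

text \<open>If the odd part \<open>m\<close> of \<open>n\<close> were 1, then \<open>n\<close> would
  be a power of 2. So \<open>m\<close> has a prime factor, which is odd because \<open>m\<close>
  is.\<close>

lemma odd_prime_divisor_exists:
  fixes n :: nat
  assumes "n > 0" and "\<not> power_of_two n"
  shows "\<exists>q. prime q \<and> odd q \<and> q dvd n"
proof -
  obtain m where m: "n = 2 ^ multiplicity 2 n * m" "\<not> 2 dvd m"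
    using multiplicity_decompose'[of n 2] assms(1) by auto
  with assms(2) have "m \<noteq> 1"
    unfolding power_of_two_def by (metis mult.right_neutral)
  then obtain q where q: "prime q" "q dvd m"
    using prime_factor_nat by blast
  with m(2) have "odd q"
    using dvd_trans by blast
  moreover have "q dvd n"
    using q(2) m(1) by (metis dvd_mult)
  ultimately show ?thesis
    using q(1) by blast
qed

lemma smallest_odd_prime_divisor:
  fixes n :: nat
  assumes "n > 0" and "\<not> power_of_two n"
  shows "prime (smallest_odd_prime_divisor n)" "odd (smallest_odd_prime_divisor n)"
    "smallest_odd_prime_divisor n dvd n"
  using LeastI_ex[OF odd_prime_divisor_exists[OF assms]]
  unfolding smallest_odd_prime_divisor_def by blast+

lemma odd_divisor_of_sum_less_max:
  fixes q x y :: nat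
  assumes "odd q" "q dvd x + y" "odd x" "odd y" "x \<noteq> y"
  shows "q < max x y"
proof -
  have "coprime q 2"
    using assms(1) by simp
  moreover obtain c where c: "x + y = 2 * c"
    using assms(3,4) by (metis dvd_def odd_even_add)
  ultimately have "q dvd c"
    using assms(2) by (metis coprime_dvd_mult_right_iff)
  \<comment> \<open>Only for a positive \<open>c\<close> does \<open>q dvd c\<close> bound
    \<open>q\<close>; \<open>c = 0\<close> would force \<open>x = 0\<close>, which is even.\<close>
  moreover have "c > 0"
    using c assms(3) by (cases c) auto
  ultimately have "q \<le> c"
    by (simp add: dvd_imp_le)
  with c assms(5) show ?thesis
    by linarith
qed

text \<open>The recursion computes terms at the end, whereas the induction of the theorem removes
  the first term; this lemma links the two. Index 0 is excluded since there the sides are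
  \<open>Some x\<close> and \<open>None\<close>.\<close>

lemma prime_fib_Suc_shift:
  assumes "\<not> power_of_two (x + y)" and "n > 0"
  shows "prime_fib x y (Suc n) = prime_fib y (smallest_odd_prime_divisor (x + y)) n"
  using assms(2)
proof (induction n rule: less_induct)
  case (less n)
  \<comment> \<open>The recursion looks two terms back, hence two base cases; \<open>n = 2\<close>
    is the one that rests on \<open>x + y\<close> not being a power of 2.\<close>
  consider "n = 1" | "n = 2" | i where "n = Suc (Suc (Suc i))"
    using less.prems by (metis One_nat_def Suc_1 not0_implies_Suc not_gr_zero)
  then show ?case
  proof cases
    case 3
    have "prime_fib x y (Suc (Suc i)) = prime_fib y (smallest_odd_prime_divisor (x + y)) (Suc i)"
      "prime_fib x y (Suc (Suc (Suc i))) =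
        prime_fib y (smallest_odd_prime_divisor (x + y)) (Suc (Suc i))"
      using less.IH[of "Suc i"] less.IH[of "Suc (Suc i)"] 3 by auto
    then show ?thesis
      using 3 by (simp only: prime_fib.simps(4))
  qed (use assms(1) in \<open>auto simp: numeral_2_eq_2\<close>)
qed

text \<open>The third term is \<open>None\<close> by assumption, and each \<open>None\<close> forces
  the next one.\<close>

lemma prime_fib_terminated:
  assumes "power_of_two (x + y)"
  shows "prime_fib x y (Suc (Suc (Suc i))) = None"
  using assms by (induction i) (auto split: option.split)

theorem theorem2p1:
  fixes p1 p2 :: nat
  assumes "prime p1" and "odd p1"
    and "prime p2" and "odd p2"
    and "p1 \<noteq> p2"
  shows "\<exists>N\<ge>2. dom (prime_fib p1 p2) = {1..N} \<and>
           (\<exists>x y. prime_fib p1 p2 (N - 1) = Some x \<and> prime_fib p1 p2 N = Some y \<and>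
                  power_of_two (x + y))"
  using assms
  \<comment> \<open>The tie-breaking bit makes the measure drop at every single step.\<close>
proof (induction "2 * max p1 p2 + (if p1 < p2 then 1 else 0)" arbitrary: p1 p2 rule: less_induct)
  case less
  show ?case
  proof (cases "power_of_two (p1 + p2)")
    case True
    have "n \<in> dom (prime_fib p1 p2) \<longleftrightarrow> n \<in> {1..2}" for n
    proof -
      consider "n = 0" | "n = 1" | "n = 2" | i where "n = Suc (Suc (Suc i))"
        by (metis One_nat_def Suc_1 not0_implies_Suc)
      then show ?thesis
        by cases (auto simp: numeral_2_eq_2 dom_def prime_fib_terminated[OF True]
            simp del: prime_fib.simps(4))
    qed
    then have "dom (prime_fib p1 p2) = {1..2}"
      by blast
    with True show ?thesis
      by (intro exI[of _ 2]) (simp add: numeral_2_eq_2)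
  next
    case False
    define q where "q = smallest_odd_prime_divisor (p1 + p2)"
    have "p1 + p2 > 0"
      using less.prems(2) by (cases p1) auto
    then have q: "prime q" "odd q" "q dvd p1 + p2"
      using smallest_odd_prime_divisor[OF _ False] unfolding q_def by simp_all
    have "p2 \<noteq> q"
    proof
      assume "p2 = q"
      with q(3) have "p2 dvd p1"
        by (simp add: dvd_add_left_iff)
      with less.prems show False
        using primes_dvd_imp_eq[of p2 p1] by simp
    qed
    moreover have "q < max p1 p2"
      using odd_divisor_of_sum_less_max[OF q(2,3) less.prems(2,4,5)] .
    \<comment> \<open>If \<open>p1 < p2\<close>, then \<open>q < p2\<close>: the maximum stays
      \<open>p2\<close>, but the bit falls from 1 to 0. If \<open>p2 < p1\<close>, both
      \<open>p2\<close> and \<open>q\<close> are below \<open>p1\<close>, and the factor 2 outweighs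
      a bit that may rise.\<close>
    then have "2 * max p2 q + (if p2 < q then 1 else 0) <
        2 * max p1 p2 + (if p1 < p2 then 1 else 0)"
      using less.prems(5) by (auto simp: max_def split: if_splits)
    ultimately obtain N x y where N: "N \<ge> 2" "dom (prime_fib p2 q) = {1..N}"
      "prime_fib p2 q (N - 1) = Some x" "prime_fib p2 q N = Some y" "power_of_two (x + y)"
      using less.hyps[OF _ less.prems(3,4) q(1,2)] by blast
    have shift: "prime_fib p1 p2 (Suc n) = prime_fib p2 q n" if "n > 0" for n
      using prime_fib_Suc_shift[OF False that] unfolding q_def .
    have "n \<in> dom (prime_fib p1 p2) \<longleftrightarrow> n \<in> {1..Suc N}" for n
    proof -
      \<comment> \<open>Shifting sends \<open>{1..N}\<close> to \<open>{2..Suc N}\<close>; the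
        removed first term supplies index 1.\<close>
      consider "n = 0" | "n = 1" | m where "n = Suc m" "m > 0"
        by (metis One_nat_def not0_implies_Suc not_gr_zero)
      then show ?thesis
      proof cases
        case 3
        then have "n \<in> dom (prime_fib p1 p2) \<longleftrightarrow> m \<in> dom (prime_fib p2 q)"
          by (simp add: domIff shift)
        with 3 N(2) show ?thesis
          by auto
      qed (auto simp: dom_def)
    qed
    then have "dom (prime_fib p1 p2) = {1..Suc N}"
      by blast
    \<comment> \<open>As \<open>N \<ge> 2\<close>, the index \<open>N - 1\<close> is positive too,
      so both final terms can be shifted.\<close>
    moreover have "prime_fib p1 p2 (Suc N - 1) = Some x" "prime_fib p1 p2 (Suc N) = Some y"
      using shift[of "N - 1"] shift[of N] N by auto
    ultimately show ?thesis
      using N(1,5) by (intro exI[of _ "Suc N"]) auto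
  qed
qed

end
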